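(* Let $\sigma>1$, let $\varphi=(\varphi_1,\dots,\varphi_b)$ be a solid $b$-fold $k$-coloring of $G_{[1,2]}$, let $\eta$ be a shading of $\varphi$, and let $(D_i)_{i\in[n]}$ be a sequence of disks with diameters in $[1,\sigma]$. Then algorithm BranchFoldColor with $\varphi,\eta$ on input $(D_i)_{i\in[n]}$ returns a proper coloring $c$ of $G=G((D_i)_{i\in[n]})$, each color being a pair $(j,x)$, such that at most $\lceil\log_2\sigma\rceil$ values of $j$ occur and every second coordinate $x$ is at most $k\cdot\left\lfloor\frac{\omega(G)+(b-1)\gamma/2}{b}\right\rfloor$, where $\gamma$ is the maximum number of subtiles in one tile of $\varphi$.
   Context: $G_{[1,2]}$ is the infinite graph on $\mathbb R^2$ with two points adjacent iff their distance lies in $[1,2]$. A $b$-fold coloring of $G_{[1,2]}$ with colors $[k]$ is a tuple $(\varphi_1,\dots,\varphi_b)$, $\varphi_r:\mathbb R^2\to[k]$, with $\varphi_r(p)\ne\varphi_s(p)$ for $r\ne s$ and $\varphi_r(p_1)\ne\varphi_s(p_2)$ for all $r,s$ whenever $\mathrm{dist}(p_1,p_2)\in[1,2]$. It is solid if there are $b$ tilings of the plane into congruent tiles (layers) such that $\varphi_r$ is constant on each tile of layer $r$, any two points of one tile are at distance less than $1$, and distinct tiles of the same color (possibly from different layers) are at distance greater than $2$. A subtile is a non-empty intersection of $b$ tiles, one from each layer. A shading of $\varphi$ is a function $\eta$ from subtiles to $[b]$ such that in every tile each value is taken by the same number of subtiles. For disks $(D_i)$, $G((D_i))$ has one vertex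 $v_i$ per disk, identified with the center of $D_i$ (distinct disks give distinct vertices), with $v_iv_j$ an edge iff $D_i\cap D_j\ne\emptyset$; $\omega(G)$ is the clique number. Algorithm BranchFoldColor (online): when $D_i$ of diameter $\sigma_i$ is read, set $j=\lfloor\log_2\sigma_i\rfloor-1$ if $\sigma_i=\sigma=2^t$ for a positive integer $t$, else $j=\lfloor\log_2\sigma_i\rfloor$, and put $v_i$ into $B_j$. Let $\varphi^{(j)}$ (with its layers, tiles, subtiles and shading) be the copy of $\varphi$ scaled by the factor $2^j$. For each layer $r$ let $T_r(v_i)$ be the tile of layer $r$ of $\varphi^{(j)}$ containing $v_i$, $S=\bigcap_rT_r(v_i)$, $m$ the number of earlier vertices in $S$; set $\ell(v_i)=1+((\eta(S)-1+m)\bmod b)$; let $t(v_i)$ be the number of earlier vertices $u$ in $T_{\ell(v_i)}(v_i)$ with $\ell(u)=\ell(v_i)$; assign $c(v_i)=(j,\varphi^{(j)}_{\ell(v_i)}(v_i)+k\,t(v_i))$.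
   Formalization: The "earlier vertices" counted in m and in t(v_i) are taken to be only those in the same branch B_j as v_i; counting earlier vertices of all branches would make the bound false (many small disjoint disks in one large tile, then a large disk). *)

theory Defs
  imports "HOL-Analysis.Analysis" "HOL-Library.Ramsey"
begin

type_synonym plane = "real ^ 2"

text \<open>Layers and colors are numbered from 1, that is, \<open>[b] = {1..b}\<close> and \<open>[k] = {1..k}\<close>.\<close>

definition fold_coloring :: "nat \<Rightarrow> nat \<Rightarrow> (nat \<Rightarrow> plane \<Rightarrow> nat) \<Rightarrow> bool" where
  "fold_coloring b k \<phi> \<longleftrightarrow>
     (\<forall>r\<in>{1..b}. \<forall>p. \<phi> r p \<in> {1..k}) \<and>
     (\<forall>r\<in>{1..b}. \<forall>s\<in>{1..b}. \<forall>p. r \<noteq> s \<longrightarrow> \<phi> r p \<noteq> \<phi> s p) \<and>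
     (\<forall>r\<in>{1..b}. \<forall>s\<in>{1..b}. \<forall>p q. dist p q \<in> {1..2} \<longrightarrow> \<phi> r p \<noteq> \<phi> s q)"

definition congruent_sets :: "plane set \<Rightarrow> plane set \<Rightarrow> bool" where
  "congruent_sets T T' \<longleftrightarrow> (\<exists>f a. orthogonal_transformation f \<and> T' = (\<lambda>x. a + f x) ` T)"

definition congruent_tiling :: "plane set set \<Rightarrow> bool" where
  "congruent_tiling P \<longleftrightarrow> partition_on UNIV P \<and> (\<forall>T\<in>P. \<forall>T'\<in>P. congruent_sets T T')"

text \<open>
  \<open>L r\<close> is the set of tiles of layer \<open>r\<close>. The distance condition on two tiles of the same color is
  pointwise, as is the one on two points of a tile: half-open hexagons of diameter 1 whose distance
  is 2 as an infimum that is not attained are the intended examples.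
\<close>
definition solid_layers :: "nat \<Rightarrow> (nat \<Rightarrow> plane \<Rightarrow> nat) \<Rightarrow> (nat \<Rightarrow> plane set set) \<Rightarrow> bool" where
  "solid_layers b \<phi> L \<longleftrightarrow>
     (\<forall>r\<in>{1..b}. congruent_tiling (L r)) \<and>
     (\<forall>r\<in>{1..b}. \<forall>T\<in>L r. \<forall>p\<in>T. \<forall>q\<in>T. \<phi> r p = \<phi> r q) \<and>
     (\<forall>r\<in>{1..b}. \<forall>T\<in>L r. \<forall>p\<in>T. \<forall>q\<in>T. dist p q < 1) \<and>
     (\<forall>r\<in>{1..b}. \<forall>s\<in>{1..b}. \<forall>T\<in>L r. \<forall>T'\<in>L s. T \<noteq> T' \<longrightarrow>
        (\<forall>p\<in>T. \<forall>q\<in>T'. \<phi> r p = \<phi> s q \<longrightarrow> dist p q > 2))"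

definition solid_fold_coloring ::
    "nat \<Rightarrow> nat \<Rightarrow> (nat \<Rightarrow> plane \<Rightarrow> nat) \<Rightarrow> (nat \<Rightarrow> plane set set) \<Rightarrow> bool" where
  "solid_fold_coloring b k \<phi> L \<longleftrightarrow> fold_coloring b k \<phi> \<and> solid_layers b \<phi> L"

definition subtiles :: "nat \<Rightarrow> (nat \<Rightarrow> plane set set) \<Rightarrow> plane set set" where
  "subtiles b L = {S. S \<noteq> {} \<and> (\<exists>f. (\<forall>r\<in>{1..b}. f r \<in> L r) \<and> S = (\<Inter>r\<in>{1..b}. f r))}"

definition subtiles_in :: "nat \<Rightarrow> (nat \<Rightarrow> plane set set) \<Rightarrow> plane set \<Rightarrow> plane set set" where
  "subtiles_in b L T = {S \<in> subtiles b L. S \<subseteq> T}"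

text \<open>
  Cardinalities and the maximum below are genuine for a solid coloring: tiles of one color are more
  than 2 apart and there are \<open>k\<close> colors, so the number of tiles that meet a tile is bounded.
\<close>
definition shading :: "nat \<Rightarrow> (nat \<Rightarrow> plane set set) \<Rightarrow> (plane set \<Rightarrow> nat) \<Rightarrow> bool" where
  "shading b L \<eta> \<longleftrightarrow>
     (\<forall>S\<in>subtiles b L. \<eta> S \<in> {1..b}) \<and>
     (\<forall>r\<in>{1..b}. \<forall>T\<in>L r. \<forall>x\<in>{1..b}. \<forall>y\<in>{1..b}.
        card {S \<in> subtiles_in b L T. \<eta> S = x} = card {S \<in> subtiles_in b L T. \<eta> S = y})"

definition max_subtiles :: "nat \<Rightarrow> (nat \<Rightarrow> plane set set) \<Rightarrow> nat" where
  "max_subtiles b L = Max {card (subtiles_in b L T) | r T. r \<in> {1..b} \<and> T \<in> L r}"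

text \<open>
  The disk \<open>D\<^sub>i\<close> is the closed disk with center \<open>v i\<close> and diameter \<open>d i\<close>, for \<open>i \<in> {1..n}\<close>. The
  vertex of \<open>D\<^sub>i\<close> is the index \<open>i\<close>, so that concentric disks still have different vertices.
\<close>
definition disk :: "(nat \<Rightarrow> plane) \<Rightarrow> (nat \<Rightarrow> real) \<Rightarrow> nat \<Rightarrow> plane set" where
  "disk v d i = cball (v i) (d i / 2)"

definition disk_edges :: "nat \<Rightarrow> (nat \<Rightarrow> plane) \<Rightarrow> (nat \<Rightarrow> real) \<Rightarrow> nat set set" where
  "disk_edges n v d =
     {{i, j} | i j. i \<in> {1..n} \<and> j \<in> {1..n} \<and> i \<noteq> j \<and> disk v d i \<inter> disk v d j \<noteq> {}}"

definition clique_number :: "'a set \<Rightarrow> 'a set set \<Rightarrow> nat" where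
  "clique_number V E = Max {card K | K. K \<subseteq> V \<and> clique K E}"

definition proper_coloring :: "'a set \<Rightarrow> 'a set set \<Rightarrow> ('a \<Rightarrow> 'c) \<Rightarrow> bool" where
  "proper_coloring V E c \<longleftrightarrow> (\<forall>x\<in>V. \<forall>y\<in>V. {x, y} \<in> E \<longrightarrow> c x \<noteq> c y)"

definition scale_coloring :: "real \<Rightarrow> (nat \<Rightarrow> plane \<Rightarrow> nat) \<Rightarrow> nat \<Rightarrow> plane \<Rightarrow> nat" where
  "scale_coloring a \<phi> r p = \<phi> r (p /\<^sub>R a)"

definition scale_layers :: "real \<Rightarrow> (nat \<Rightarrow> plane set set) \<Rightarrow> nat \<Rightarrow> plane set set" where
  "scale_layers a L r = (\<lambda>T. (\<lambda>p. a *\<^sub>R p) ` T) ` L r"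

definition scale_shading :: "real \<Rightarrow> (plane set \<Rightarrow> nat) \<Rightarrow> plane set \<Rightarrow> nat" where
  "scale_shading a \<eta> S = \<eta> ((\<lambda>p. p /\<^sub>R a) ` S)"

definition tile_of :: "(nat \<Rightarrow> plane set set) \<Rightarrow> nat \<Rightarrow> plane \<Rightarrow> plane set" where
  "tile_of L r p = (THE T. T \<in> L r \<and> p \<in> T)"

definition subtile_of :: "nat \<Rightarrow> (nat \<Rightarrow> plane set set) \<Rightarrow> plane \<Rightarrow> plane set" where
  "subtile_of b L p = (\<Inter>r\<in>{1..b}. tile_of L r p)"

text \<open>
  The algorithm BranchFoldColor. The step for \<open>D\<^sub>i\<close> depends only on \<open>D\<^sub>1, \<dots>, D\<^sub>i\<close>; the earlier
  vertices that it counts are those of the branch \<open>B\<^sub>j\<close> into which \<open>v\<^sub>i\<close> is put.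
\<close>
definition branch :: "real \<Rightarrow> (nat \<Rightarrow> real) \<Rightarrow> nat \<Rightarrow> int" where
  "branch \<sigma> d i =
     (if d i = \<sigma> \<and> (\<exists>t::nat. t > 0 \<and> \<sigma> = 2 ^ t) then \<lfloor>log 2 (d i)\<rfloor> - 1 else \<lfloor>log 2 (d i)\<rfloor>)"

definition earlier :: "real \<Rightarrow> (nat \<Rightarrow> real) \<Rightarrow> nat \<Rightarrow> nat set" where
  "earlier \<sigma> d i = {u \<in> {1..<i}. branch \<sigma> d u = branch \<sigma> d i}"

definition bfc_layer ::
    "nat \<Rightarrow> (nat \<Rightarrow> plane set set) \<Rightarrow> (plane set \<Rightarrow> nat) \<Rightarrow> real \<Rightarrow> (nat \<Rightarrow> plane) \<Rightarrow> (nat \<Rightarrow> real) \<Rightarrow>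
     nat \<Rightarrow> nat" where
  "bfc_layer b L \<eta> \<sigma> v d i =
     (let a = 2 powi branch \<sigma> d i;
          S = subtile_of b (scale_layers a L) (v i);
          m = card {u \<in> earlier \<sigma> d i. v u \<in> S}
      in 1 + (scale_shading a \<eta> S - 1 + m) mod b)"

definition bfc_rank ::
    "nat \<Rightarrow> (nat \<Rightarrow> plane set set) \<Rightarrow> (plane set \<Rightarrow> nat) \<Rightarrow> real \<Rightarrow> (nat \<Rightarrow> plane) \<Rightarrow> (nat \<Rightarrow> real) \<Rightarrow>
     nat \<Rightarrow> nat" where
  "bfc_rank b L \<eta> \<sigma> v d i =
     (let a = 2 powi branch \<sigma> d i; l = bfc_layer b L \<eta> \<sigma> v d
      in card {u \<in> earlier \<sigma> d i. v u \<in> tile_of (scale_layers a L) (l i) (v i) \<and> l u = l i})"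

definition branch_fold_color ::
    "nat \<Rightarrow> nat \<Rightarrow> (nat \<Rightarrow> plane \<Rightarrow> nat) \<Rightarrow> (nat \<Rightarrow> plane set set) \<Rightarrow> (plane set \<Rightarrow> nat) \<Rightarrow> real \<Rightarrow>
     (nat \<Rightarrow> plane) \<Rightarrow> (nat \<Rightarrow> real) \<Rightarrow> nat \<Rightarrow> int \<times> nat" where
  "branch_fold_color b k \<phi> L \<eta> \<sigma> v d i =
     (branch \<sigma> d i,
      scale_coloring (2 powi branch \<sigma> d i) \<phi> (bfc_layer b L \<eta> \<sigma> v d i) (v i)
        + k * bfc_rank b L \<eta> \<sigma> v d i)"

end

theory Submission
  imports Defs
begin

text \<open>
  Adjacent vertices of one branch have scaled distance at most 2, so equal colors of \<open>\<phi>\<close> force them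
  into the same tile of the same layer, where the ranks differ. All branch vertices in a tile of the
  chosen layer form a clique, and the cyclic choice of layers within each subtile splits this clique
  almost evenly among the \<open>b\<close> layers; the shading makes the rounding errors of the subtiles
  cancel on average, leaving at most \<open>(b - 1) / 2\<close> per subtile.
\<close>

subsection \<open>Cyclic counting\<close>

text \<open>The rank is strictly increasing on \<open>A\<close> and stays below
  \<open>card A\<close>, so it is injective into a set of the same finite size. It translates
  counting in order of arrival into counting on an initial segment of the naturals.\<close>

lemma bij_betw_rank:
  fixes A :: "nat set"
  assumes "finite A"
  shows "bij_betw (\<lambda>u. card {u' \<in> A. u' < u}) A {..<card A}"
proof -
  let ?f = "\<lambda>u. card {u' \<in> A. u' < u}"
  have mono: "?f x < ?f y" if "x \<in> A" "x < y" for x y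
    using that assms by (intro psubset_card_mono) (auto dest: less_trans)
  have inj: "inj_on ?f A"
    by (rule linorder_inj_onI) (use mono in \<open>fastforce+\<close>)
  have "?f u < card A" if "u \<in> A" for u
    using that assms by (intro psubset_card_mono) auto
  then have "?f ` A \<subseteq> {..<card A}" by auto
  moreover have "card (?f ` A) = card {..<card A}"
    using inj by (simp add: card_image)
  ultimately have "?f ` A = {..<card A}"
    by (simp add: card_subset_eq)
  with inj show ?thesis by (simp add: bij_betw_def)
qed

text \<open>When \<open>N\<close> grows by one, the subtracted residue grows by one too and cancels
  the change, unless it wraps from \<open>b - 1\<close> to 0. The wrap happens exactly when
  \<open>e + N\<close> hits the class of \<open>l\<close>, and it raises the right-hand side by
  \<open>b\<close>. Integers are used because \<open>e - l - 1\<close> may be negative.\<close>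

lemma card_residues_eq:
  fixes b e l N :: nat
  assumes "l < b"
  shows "int b * int (card {m \<in> {..<N}. (e + m) mod b = l}) =
    int N + (int e - int l - 1) mod int b - (int e + int N - int l - 1) mod int b"
proof (induction N)
  case 0
  then show ?case by simp
next
  case (Suc N)
  \<comment> \<open>The residue of \<open>?y\<close> is the term subtracted for \<open>N\<close>;
    the one for \<open>Suc N\<close> belongs to \<open>?y + 1\<close>.\<close>
  let ?y = "int e + int N - int l - 1"
  have split: "{m \<in> {..<Suc N}. (e + m) mod b = l} =
      (if (e + N) mod b = l then insert N {m \<in> {..<N}. (e + m) mod b = l}
       else {m \<in> {..<N}. (e + m) mod b = l})"
    by (auto simp: less_Suc_eq)
  have hit: "(e + N) mod b = l \<longleftrightarrow> (?y + 1) mod int b = 0"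
  proof -
    have "(e + N) mod b = l \<longleftrightarrow> (int e + int N) mod int b = int l mod int b"
      using assms by (metis mod_less of_nat_add of_nat_eq_iff zmod_int)
    also have "\<dots> \<longleftrightarrow> (?y + 1) mod int b = 0"
      by (simp add: mod_eq_dvd_iff dvd_eq_mod_eq_0)
    finally show ?thesis .
  qed
  have rem: "(?y + 1) mod int b = (?y mod int b + 1) mod int b"
    by (rule mod_add_left_eq[symmetric])
  have bounds: "0 \<le> ?y mod int b" "?y mod int b < int b"
    using assms by auto
  have step: "(?y + 1) mod int b = (if ?y mod int b = int b - 1 then 0 else ?y mod int b + 1)"
  proof (cases "?y mod int b = int b - 1")
    case False
    with bounds have "(?y mod int b + 1) mod int b = ?y mod int b + 1"
      by (intro mod_pos_pos_trivial) auto
    with rem False show ?thesis by simp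
  next
    case True
    then show ?thesis unfolding rem by simp
  qed
  have shift: "int e + int (Suc N) - int l - 1 = ?y + 1" by simp
  show ?case
  proof (cases "?y mod int b = int b - 1")
    case True
    then have "(e + N) mod b = l" using hit step by simp
    then show ?thesis
      unfolding split shift step using Suc True by (simp add: algebra_simps)
  next
    case False
    then have "(e + N) mod b \<noteq> l" using hit step bounds by auto
    then show ?thesis
      unfolding split shift step using Suc False by simp
  qed
qed

text \<open>By the rank bijection this is a count of residues on \<open>{..<card A}\<close>; the
  subtracted residue in the exact formula is nonnegative and is dropped.\<close>

lemma card_cyclic_le:
  fixes A :: "nat set" and b e l :: nat
  assumes "finite A" "l < b"
  shows "int b * int (card {u \<in> A. (e + card {u' \<in> A. u' < u}) mod b = l}) \<le>
    int (card A) + (int e - int l - 1) mod int b"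
proof -
  let ?f = "\<lambda>u. card {u' \<in> A. u' < u}"
  have "bij_betw ?f {u \<in> A. (e + ?f u) mod b = l} {m \<in> {..<card A}. (e + m) mod b = l}"
    using bij_betw_rank[OF assms(1)] unfolding bij_betw_def inj_on_def by auto
  then have "card {u \<in> A. (e + ?f u) mod b = l} = card {m \<in> {..<card A}. (e + m) mod b = l}"
    by (rule bij_betw_same_card)
  then show ?thesis
    using card_residues_eq[OF assms(2), of "card A" e] assms by simp
qed

text \<open>As \<open>x\<close> runs through \<open>b\<close> consecutive integers,
  \<open>x - z\<close> meets each residue class once, so the sum is that of 0 to
  \<open>b - 1\<close>. The factor 2 avoids a division.\<close>

lemma sum_shifted_residues:
  fixes b :: nat and z :: int
  assumes "b > 0"
  shows "2 * (\<Sum>x\<in>{1..b}. (int x - z) mod int b) = int b * (int b - 1)"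
proof -
  let ?g = "\<lambda>x. nat ((int x - z) mod int b)"
  have inj: "inj_on ?g {1..b}"
  proof (rule inj_onI)
    fix x y assume xy: "x \<in> {1..b}" "y \<in> {1..b}" "?g x = ?g y"
    then have "(int x - z) mod int b = (int y - z) mod int b"
      using assms by (simp add: nat_eq_iff)
    then have "int b dvd int x - int y" by (simp add: mod_eq_dvd_iff)
    moreover have "\<bar>int x - int y\<bar> < int b" using xy by auto
    ultimately show "x = y" using zdvd_not_zless[of "\<bar>int x - int y\<bar>" "int b"]
      by (cases "x = y") auto
  qed
  have "?g ` {1..b} \<subseteq> {..<b}"
    using assms by (auto simp: nat_less_iff)
  then have "?g ` {1..b} = {..<b}"
    using inj by (intro card_subset_eq) (auto simp: card_image)
  then have "(\<Sum>x\<in>{1..b}. int (?g x)) = (\<Sum>m<b. int m)"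
    using inj by (metis (no_types, lifting) sum.reindex_cong)
  moreover have "2 * (\<Sum>m<b. int m) = int b * (int b - 1)" for b
    by (induction b) (auto simp: algebra_simps)
  ultimately show ?thesis using assms by simp
qed

subsection \<open>Tiles and subtiles\<close>

lemma tile_of_eq:
  assumes "partition_on UNIV (L r)" "T \<in> L r" "p \<in> T"
  shows "tile_of L r p = T"
  unfolding tile_of_def
  using assms by (intro the_equality) (auto dest: partition_onD2 disjointD)

lemma tile_of_mem:
  assumes "partition_on UNIV (L r)"
  shows "tile_of L r p \<in> L r" "p \<in> tile_of L r p"
proof -
  obtain T where "T \<in> L r" "p \<in> T"
    using partition_onD1[OF assms] by blast
  with tile_of_eq[where L = L, OF assms] show "tile_of L r p \<in> L r" "p \<in> tile_of L r p" by auto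
qed

lemma mem_tile_of_iff:
  assumes "partition_on UNIV (L r)"
  shows "q \<in> tile_of L r p \<longleftrightarrow> tile_of L r q = tile_of L r p"
  using tile_of_mem[where L = L, OF assms] tile_of_eq[where L = L, OF assms] by metis

text \<open>Scaling back by \<open>a\<close> turns every question about the scaled layers into one
  about \<open>L\<close> at points divided by \<open>a\<close>, so the counting can be done in the
  original coloring.\<close>

lemma tile_of_scale:
  assumes "partition_on UNIV (L r)" "a \<noteq> 0"
  shows "tile_of (scale_layers a L) r p = (\<lambda>x. a *\<^sub>R x) ` tile_of L r (p /\<^sub>R a)"
proof -
  have mem: "q \<in> (\<lambda>x. a *\<^sub>R x) ` T \<longleftrightarrow> q /\<^sub>R a \<in> T" for q and T :: "plane set"
    using assms(2) by (force simp: image_iff)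
  have "U = (\<lambda>x. a *\<^sub>R x) ` tile_of L r (p /\<^sub>R a)" if U: "U \<in> scale_layers a L r" "p \<in> U" for U
  proof -
    obtain T where T: "T \<in> L r" "U = (\<lambda>x. a *\<^sub>R x) ` T"
      using U(1) by (auto simp: scale_layers_def)
    with U(2) have "p /\<^sub>R a \<in> T" using mem by blast
    with tile_of_eq[where L = L, OF assms(1)] T show ?thesis by simp
  qed
  moreover have "(\<lambda>x. a *\<^sub>R x) ` tile_of L r (p /\<^sub>R a) \<in> scale_layers a L r"
    "p \<in> (\<lambda>x. a *\<^sub>R x) ` tile_of L r (p /\<^sub>R a)"
    using tile_of_mem[where L = L, OF assms(1)] by (auto simp: scale_layers_def mem)
  ultimately show ?thesis
    unfolding tile_of_def[of "scale_layers a L"] by (intro the_equality conjI) blast+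
qed

lemma mem_scaled_tile_of_iff:
  assumes "partition_on UNIV (L r)" "a \<noteq> 0"
  shows "q \<in> tile_of (scale_layers a L) r p \<longleftrightarrow> q /\<^sub>R a \<in> tile_of L r (p /\<^sub>R a)"
  unfolding tile_of_scale[where L = L, OF assms] using assms(2) by (force simp: image_iff)

lemma mem_scaled_subtile_of_iff:
  assumes "\<forall>r\<in>{1..b}. partition_on UNIV (L r)" "a \<noteq> 0"
  shows "q \<in> subtile_of b (scale_layers a L) p \<longleftrightarrow> q /\<^sub>R a \<in> subtile_of b L (p /\<^sub>R a)"
  using mem_scaled_tile_of_iff[where L = L, OF bspec[OF assms(1)] assms(2)] unfolding subtile_of_def INT_iff
  by blast

lemma scale_shading_subtile_of:
  assumes "\<forall>r\<in>{1..b}. partition_on UNIV (L r)" "a \<noteq> 0"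
  shows "scale_shading a \<eta> (subtile_of b (scale_layers a L) p) = \<eta> (subtile_of b L (p /\<^sub>R a))"
proof -
  have "(\<lambda>q. q /\<^sub>R a) ` subtile_of b (scale_layers a L) p = subtile_of b L (p /\<^sub>R a)"
  proof (intro set_eqI iffI)
    fix x assume "x \<in> subtile_of b L (p /\<^sub>R a)"
    then have "a *\<^sub>R x \<in> subtile_of b (scale_layers a L) p"
      using mem_scaled_subtile_of_iff[OF assms] assms(2) by simp
    then show "x \<in> (\<lambda>q. q /\<^sub>R a) ` subtile_of b (scale_layers a L) p"
      using assms(2) by (intro image_eqI[of _ _ "a *\<^sub>R x"]) auto
  qed (use mem_scaled_subtile_of_iff[OF assms] in auto)
  then show ?thesis by (simp add: scale_shading_def)
qed

lemma mem_subtile_of_iff: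
  assumes "\<forall>r\<in>{1..b}. partition_on UNIV (L r)"
  shows "q \<in> subtile_of b L p \<longleftrightarrow> subtile_of b L q = subtile_of b L p"
proof
  assume "q \<in> subtile_of b L p"
  then show "subtile_of b L q = subtile_of b L p"
    using mem_tile_of_iff[where L = L, OF bspec[OF assms]] by (auto simp: subtile_of_def)
next
  assume "subtile_of b L q = subtile_of b L p"
  moreover have "q \<in> subtile_of b L q"
    using tile_of_mem[where L = L, OF bspec[OF assms]] by (auto simp: subtile_of_def)
  ultimately show "q \<in> subtile_of b L p" by simp
qed

text \<open>A point of \<open>S\<close> lies in only one tile of each layer, which fixes all the
  tiles intersected to form \<open>S\<close>.\<close>

lemma subtile_eq_subtile_of:
  assumes "\<forall>r\<in>{1..b}. partition_on UNIV (L r)" "S \<in> subtiles b L" "p \<in> S"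
  shows "S = subtile_of b L p"
proof -
  obtain f where f: "\<forall>r\<in>{1..b}. f r \<in> L r" "S = (\<Inter>r\<in>{1..b}. f r)"
    using assms(2) by (auto simp: subtiles_def)
  with assms(3) have "tile_of L r p = f r" if "r \<in> {1..b}" for r
    using that assms(1) by (intro tile_of_eq) auto
  with f(2) show ?thesis by (simp add: subtile_of_def)
qed

lemma subtile_of_in_subtiles_in:
  assumes "\<forall>r\<in>{1..b}. partition_on UNIV (L r)" "r \<in> {1..b}" "T \<in> L r" "p \<in> T"
  shows "subtile_of b L p \<in> subtiles_in b L T"
proof -
  have "tile_of L r p = T" using assms by (intro tile_of_eq) auto
  then have "subtile_of b L p \<subseteq> T" using assms(2) by (auto simp: subtile_of_def)
  moreover have "subtile_of b L p \<noteq> {}"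
    using mem_subtile_of_iff[OF assms(1), of p p] by auto
  ultimately show ?thesis
    using tile_of_mem(1)[where L = L, OF bspec[OF assms(1)]]
    by (auto simp: subtiles_in_def subtiles_def subtile_of_def
        intro!: exI[of _ "\<lambda>r. tile_of L r p"])
qed

section \<open>Consequences of solidity\<close>

lemma solid_partition:
  assumes "solid_fold_coloring b k \<phi> L"
  shows "\<forall>r\<in>{1..b}. partition_on UNIV (L r)"
proof -
  have "\<forall>r\<in>{1..b}. congruent_tiling (L r)"
    using assms unfolding solid_fold_coloring_def solid_layers_def by (elim conjE)
  then show ?thesis by (simp add: congruent_tiling_def)
qed

lemma solid_tile_const:
  assumes "solid_fold_coloring b k \<phi> L" "r \<in> {1..b}" "T \<in> L r" "p \<in> T" "q \<in> T"
  shows "\<phi> r p = \<phi> r q"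
proof -
  have "\<forall>r\<in>{1..b}. \<forall>T\<in>L r. \<forall>p\<in>T. \<forall>q\<in>T. \<phi> r p = \<phi> r q"
    using assms(1) unfolding solid_fold_coloring_def solid_layers_def by (elim conjE)
  with assms show ?thesis by blast
qed

lemma solid_tile_dist:
  assumes "solid_fold_coloring b k \<phi> L" "r \<in> {1..b}" "T \<in> L r" "p \<in> T" "q \<in> T"
  shows "dist p q < 1"
proof -
  have "\<forall>r\<in>{1..b}. \<forall>T\<in>L r. \<forall>p\<in>T. \<forall>q\<in>T. dist p q < 1"
    using assms(1) unfolding solid_fold_coloring_def solid_layers_def by (elim conjE)
  with assms show ?thesis by blast
qed

lemma solid_close_tile:
  assumes "solid_fold_coloring b k \<phi> L" "r \<in> {1..b}" "s \<in> {1..b}"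
    and "\<phi> r p = \<phi> s q" "dist p q \<le> 2"
  shows "r = s" "tile_of L r p = tile_of L s q"
proof -
  note part = bspec[OF solid_partition[OF assms(1)]]
  note P = tile_of_mem[where L = L, OF part[OF assms(2)], of p]
    and Q = tile_of_mem[where L = L, OF part[OF assms(3)], of q]
  show eq: "tile_of L r p = tile_of L s q"
    using assms P Q unfolding solid_fold_coloring_def solid_layers_def by (meson not_less)
  \<comment> \<open>The separation condition compares tiles as sets, and one set could be a tile of
    two layers. In that case \<open>q\<close> would get the same color from layers \<open>r\<close>
    and \<open>s\<close>, which a fold coloring allows only for \<open>r = s\<close>.\<close>
  have "\<phi> r q = \<phi> r p"
    by (rule solid_tile_const[OF assms(1,2) P(1)]) (use P Q eq in simp_all)
  then have "\<phi> r q = \<phi> s q" using assms(4) by simp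
  moreover have "\<forall>r\<in>{1..b}. \<forall>s\<in>{1..b}. \<forall>p. r \<noteq> s \<longrightarrow> \<phi> r p \<noteq> \<phi> s p"
    using assms(1) unfolding solid_fold_coloring_def fold_coloring_def by (elim conjE)
  ultimately show "r = s" using assms(2,3) by blast
qed

text \<open>Two tiles of one layer and one color cannot both meet a tile, so a subtile of a given tile is
  determined by its \<open>b\<close>-tuple of colors.\<close>
lemma subtiles_in_bound:
  assumes "solid_fold_coloring b k \<phi> L" "r \<in> {1..b}" "T \<in> L r"
  shows "finite (subtiles_in b L T)" "card (subtiles_in b L T) \<le> k ^ b"
proof -
  define pt where "pt S = (SOME p. p \<in> S)" for S :: "plane set"
  \<comment> \<open>The tuple is restricted to \<open>{1..b}\<close> so that it is an extensional
    function, an element of a finite product of size \<open>k ^ b\<close>.\<close>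
  define h where "h S = (\<lambda>s\<in>{1..b}. \<phi> s (pt S))" for S
  have pt: "pt S \<in> S" if "S \<in> subtiles_in b L T" for S
    using that some_in_eq[of S] unfolding pt_def subtiles_in_def subtiles_def by blast
  have inj: "inj_on h (subtiles_in b L T)"
  proof (rule inj_onI)
    fix S S' assume S: "S \<in> subtiles_in b L T" "S' \<in> subtiles_in b L T" and eq: "h S = h S'"
    have "pt S \<in> T" "pt S' \<in> T" using pt S by (auto simp: subtiles_in_def)
    then have "dist (pt S) (pt S') < 1"
      by (rule solid_tile_dist[OF assms])
    moreover have "\<phi> s (pt S) = \<phi> s (pt S')" if "s \<in> {1..b}" for s
      using fun_cong[OF eq, of s] that by (simp add: h_def)
    ultimately have "tile_of L s (pt S) = tile_of L s (pt S')" if "s \<in> {1..b}" for s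
      using that by (intro solid_close_tile(2)[OF assms(1) that that]) auto
    then have "subtile_of b L (pt S) = subtile_of b L (pt S')"
      by (simp add: subtile_of_def)
    then show "S = S'"
      using subtile_eq_subtile_of[OF solid_partition[OF assms(1)]] S pt
      by (metis (no_types, lifting) mem_Collect_eq subtiles_in_def)
  qed
  have sub: "h ` subtiles_in b L T \<subseteq> {1..b} \<rightarrow>\<^sub>E {1..k}"
    using assms(1) unfolding h_def solid_fold_coloring_def fold_coloring_def by auto
  have fin: "finite ({1..b} \<rightarrow>\<^sub>E {1..k})" by (simp add: finite_PiE)
  show "finite (subtiles_in b L T)"
    using inj sub fin finite_imageD finite_subset by metis
  show "card (subtiles_in b L T) \<le> k ^ b"
    using card_inj_on_le[OF inj sub fin] by (simp add: card_PiE)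
qed

text \<open>\<open>Max\<close> is meaningful only on a finite set; the bound \<open>k ^ b\<close>,
  uniform over all tiles, makes the set of cardinalities finite.\<close>

lemma card_subtiles_in_le_max:
  assumes "solid_fold_coloring b k \<phi> L" "r \<in> {1..b}" "T \<in> L r"
  shows "card (subtiles_in b L T) \<le> max_subtiles b L"
  unfolding max_subtiles_def
proof (rule Max_ge)
  have "{card (subtiles_in b L T) | r T. r \<in> {1..b} \<and> T \<in> L r} \<subseteq> {..k ^ b}"
    using subtiles_in_bound(2)[OF assms(1)] by auto
  then show "finite {card (subtiles_in b L T) | r T. r \<in> {1..b} \<and> T \<in> L r}"
    by (rule finite_subset) simp
qed (use assms in blast)

section \<open>Shadings and the load of one layer\<close>

lemma shading_pos:
  assumes "shading b L \<eta>"
  shows "b > 0"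
proof (rule ccontr)
  assume "\<not> b > 0"
  \<comment> \<open>For \<open>b = 0\<close> the empty intersection is the whole plane, and its
    shade would have to lie in the empty set \<open>{1..0}\<close>.\<close>
  then have "UNIV \<in> subtiles b L" by (auto simp: subtiles_def)
  with assms \<open>\<not> b > 0\<close> show False by (auto simp: shading_def)
qed

text \<open>All shades occur equally often in \<open>T\<close>, say \<open>g\<close> times, so the
  sum is \<open>g\<close> times that of a complete residue system, while the number of subtiles is
  \<open>b * g\<close>.\<close>

lemma sum_shading:
  assumes "shading b L \<eta>" "r \<in> {1..b}" "T \<in> L r" "finite (subtiles_in b L T)"
  shows "2 * (\<Sum>S\<in>subtiles_in b L T. (int (\<eta> S) - z) mod int b) =
    int (card (subtiles_in b L T)) * (int b - 1)"
proof -
  let ?X = "subtiles_in b L T"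
  define g where "g = card {S \<in> ?X. \<eta> S = r}"
  have g: "card {S \<in> ?X. \<eta> S = x} = g" if "x \<in> {1..b}" for x
    using assms that unfolding g_def shading_def by blast
  have img: "\<eta> ` ?X \<subseteq> {1..b}"
    using assms(1) by (auto simp: shading_def subtiles_in_def)
  have "(\<Sum>S\<in>?X. (int (\<eta> S) - z) mod int b) =
      (\<Sum>x\<in>{1..b}. \<Sum>S\<in>{S \<in> ?X. \<eta> S = x}. (int (\<eta> S) - z) mod int b)"
    by (rule sum.group[symmetric]) (use assms(4) img in auto)
  also have "\<dots> = (\<Sum>x\<in>{1..b}. int g * ((int x - z) mod int b))"
    by (rule sum.cong) (use g in auto)
  finally have 1: "(\<Sum>S\<in>?X. (int (\<eta> S) - z) mod int b) =
      int g * (\<Sum>x\<in>{1..b}. (int x - z) mod int b)"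
    by (simp add: sum_distrib_left)
  have "card ?X = (\<Sum>x\<in>{1..b}. \<Sum>S\<in>{S \<in> ?X. \<eta> S = x}. 1)"
    using sum.group[of ?X "{1..b}" \<eta> "\<lambda>_. 1 :: nat"] assms(4) img by simp
  also have "\<dots> = b * g" using g by simp
  finally have 2: "card ?X = b * g" .
  show ?thesis
    unfolding 1 2 using sum_shifted_residues[OF shading_pos[OF assms(1)], of z]
    by (metis mult.assoc mult.commute of_nat_mult)
qed

text \<open>The \<open>n\<^sub>S\<close> vertices in a subtile \<open>S\<close> run cyclically through the layers starting at \<open>\<eta> S\<close>, so
  layer \<open>r\<close> gets at most \<open>(n\<^sub>S + (\<eta> S - r - 1) mod b) / b\<close> of them; by the shading property the
  residues average to \<open>(b - 1) / 2\<close> over the subtiles of a tile.\<close>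
lemma card_layer_in_tile_le:
  fixes w :: "nat \<Rightarrow> plane"
  assumes solid: "solid_fold_coloring b k \<phi> L" and sh: "shading b L \<eta>"
    and r: "r \<in> {1..b}" and T: "T \<in> L r" and A: "finite A"
    and lay: "\<And>u. u \<in> A \<Longrightarrow> lay u = 1 + (\<eta> (subtile_of b L (w u)) - 1 +
      card {u' \<in> A. u' < u \<and> w u' \<in> subtile_of b L (w u)}) mod b"
  shows "2 * int b * int (card {u \<in> A. w u \<in> T \<and> lay u = r}) \<le>
    2 * int (card {u \<in> A. w u \<in> T}) + (int b - 1) * int (card (subtiles_in b L T))"
proof -
  let ?X = "subtiles_in b L T" and ?s = "\<lambda>u. subtile_of b L (w u)"
  note part = solid_partition[OF solid]
  have finX: "finite ?X" by (rule subtiles_in_bound(1)[OF solid r T])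
  have inX: "?s u \<in> ?X" if "w u \<in> T" for u
    using subtile_of_in_subtiles_in[OF part r T that] .
  have inT: "w u \<in> T" if "?s u \<in> ?X" for u
    using that mem_subtile_of_iff[OF part, of "w u" "w u"] by (auto simp: subtiles_in_def)
  \<comment> \<open>Vertices in \<open>T\<close> are sorted by their subtile. The predicate
    \<open>P\<close> is free so that the same splitting serves for the vertices of layer
    \<open>r\<close> and for all vertices of the tile.\<close>
  have group: "int (card {u \<in> A. w u \<in> T \<and> P u}) = (\<Sum>S\<in>?X. int (card {u \<in> A. ?s u = S \<and> P u}))"
    for P
  proof -
    have "int (card {u \<in> A. w u \<in> T \<and> P u}) =
        (\<Sum>S\<in>?X. \<Sum>u\<in>{u \<in> {u \<in> A. w u \<in> T \<and> P u}. ?s u = S}. 1)"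
      using sum.group[of "{u \<in> A. w u \<in> T \<and> P u}" ?X ?s "\<lambda>_. 1 :: int"] A finX inX
      by (simp add: image_subset_iff)
    also have "\<dots> = (\<Sum>S\<in>?X. int (card {u \<in> A. ?s u = S \<and> P u}))"
    proof (rule sum.cong)
      fix S assume "S \<in> ?X"
      then have "{u \<in> {u \<in> A. w u \<in> T \<and> P u}. ?s u = S} = {u \<in> A. ?s u = S \<and> P u}"
        using inT by auto
      then show "(\<Sum>u\<in>{u \<in> {u \<in> A. w u \<in> T \<and> P u}. ?s u = S}. 1) =
          int (card {u \<in> A. ?s u = S \<and> P u})" by simp
    qed simp
    finally show ?thesis .
  qed
  have each: "int b * int (card {u \<in> A. ?s u = S \<and> lay u = r}) \<le>
      int (card {u \<in> A. ?s u = S}) + (int (\<eta> S) - (int r + 1)) mod int b" if S: "S \<in> ?X" for S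
  proof -
    let ?A = "{u \<in> A. ?s u = S}"
    have \<eta>: "\<eta> S \<ge> 1" using sh S by (auto simp: shading_def subtiles_in_def)
    have "lay u = 1 + (\<eta> S - 1 + card {u' \<in> ?A. u' < u}) mod b" if "u \<in> ?A" for u
    proof -
      \<comment> \<open>Among the vertices of one subtile, the counter of the algorithm is the rank
        within \<open>?A\<close>, as cyclic counting requires.\<close>
      have "{u' \<in> A. u' < u \<and> w u' \<in> ?s u} = {u' \<in> ?A. u' < u}"
        using that mem_subtile_of_iff[OF part] by auto
      with lay[of u] that show ?thesis by auto
    qed
    then have "{u \<in> A. ?s u = S \<and> lay u = r} =
        {u \<in> ?A. (\<eta> S - 1 + card {u' \<in> ?A. u' < u}) mod b = r - 1}"
      using r by auto
    then have "int b * int (card {u \<in> A. ?s u = S \<and> lay u = r}) \<le>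
        int (card ?A) + (int (\<eta> S - 1) - int (r - 1) - 1) mod int b"
      using card_cyclic_le[of ?A "r - 1" b "\<eta> S - 1"] A r by auto
    \<comment> \<open>Shades and layers start at 1 but residues at 0; the two shifts cancel, and
      both natural subtractions are exact since \<eta> and \<open>r\<close> are at least 1.\<close>
    moreover have "int (\<eta> S - 1) - int (r - 1) - 1 = int (\<eta> S) - (int r + 1)"
      using \<eta> r by auto
    ultimately show ?thesis by metis
  qed
  have "2 * int b * int (card {u \<in> A. w u \<in> T \<and> lay u = r}) =
      2 * (\<Sum>S\<in>?X. int b * int (card {u \<in> A. ?s u = S \<and> lay u = r}))"
    unfolding group by (simp add: sum_distrib_left mult.assoc)
  also have "\<dots> \<le> 2 * (\<Sum>S\<in>?X. int (card {u \<in> A. ?s u = S}) +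
      (int (\<eta> S) - (int r + 1)) mod int b)"
    using sum_mono[OF each] by simp
  also have "\<dots> = 2 * int (card {u \<in> A. w u \<in> T}) + (int b - 1) * int (card ?X)"
    using group[of "\<lambda>_. True"] sum_shading[OF sh r T finX, of "int r + 1"]
    by (simp add: sum.distrib algebra_simps)
  finally show ?thesis .
qed

subsection \<open>Branches\<close>

text \<open>Usually the floor of the logarithm gives even a strict upper bound. In the exceptional
  case \<open>d i\<close> is \<open>2 ^ t\<close> and the branch is \<open>t - 1\<close>, so the
  upper bound is attained.\<close>

lemma branch_bounds:
  assumes "d i \<ge> 1"
  shows "2 powi branch \<sigma> d i \<le> d i" "d i \<le> 2 * 2 powi branch \<sigma> d i"
proof -
  have "2 powi \<lfloor>log 2 (d i)\<rfloor> \<le> d i" "d i < 2 powi (\<lfloor>log 2 (d i)\<rfloor> + 1)"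
    using floor_log_eq_powr_iff[of "d i" 2 "\<lfloor>log 2 (d i)\<rfloor>"] assms
    by (auto simp: powr_real_of_int'[symmetric])
  moreover have "branch \<sigma> d i = int t - 1" "d i = 2 powi (int t)"
    if "d i = \<sigma>" "\<sigma> = 2 ^ t" "t > 0" for t
    using that by (auto simp: branch_def power_int_def)
  ultimately show "2 powi branch \<sigma> d i \<le> d i" "d i \<le> 2 * 2 powi branch \<sigma> d i"
    by (auto simp: branch_def power_int_add power_int_diff split: if_splits)
qed

text \<open>If \<sigma> is \<open>2 ^ t\<close>, only diameter \<sigma> itself would reach branch
  \<open>t\<close>, and the exception moves it down to \<open>t - 1\<close>. Otherwise
  \<open>log 2 \<sigma>\<close> is not an integer, so its floor lies strictly below its
  ceiling.\<close>

lemma branch_range: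
  assumes "\<sigma> > 1" "d i \<in> {1..\<sigma>}"
  shows "branch \<sigma> d i \<in> {0..<\<lceil>log 2 \<sigma>\<rceil>}"
proof (cases "\<exists>t::nat. t > 0 \<and> \<sigma> = 2 ^ t")
  case True
  then obtain t :: nat where t: "t > 0" "\<sigma> = 2 ^ t" by blast
  then have log: "log 2 \<sigma> = real t" by (simp add: log_nat_power)
  have "d i < \<sigma> \<Longrightarrow> log 2 (d i) < real t" using assms log by (metis atLeastAtMost_iff log_less
        one_less_numeral_iff semiring_norm(76) less_le_trans zero_less_one)
  with t log assms show ?thesis
    by (cases "d i = \<sigma>") (auto simp: branch_def floor_less_iff)
next
  case False
  then have eq: "branch \<sigma> d i = \<lfloor>log 2 (d i)\<rfloor>" by (auto simp: branch_def)
  have nonneg: "log 2 (d i) \<ge> 0" and le: "log 2 (d i) \<le> log 2 \<sigma>"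
    using assms by (auto simp: log_le_cancel_iff)
  have "log 2 \<sigma> \<noteq> real_of_int z" for z
  proof
    assume z: "log 2 \<sigma> = real_of_int z"
    moreover have "log 2 \<sigma> > 0" using assms by simp
    ultimately have "z > 0" by simp
    have "\<sigma> = 2 powr (log 2 \<sigma>)" using assms by simp
    also have "\<dots> = 2 ^ nat z" using \<open>z > 0\<close> z by (simp add: powr_realpow[symmetric])
    finally show False using False \<open>z > 0\<close> by auto
  qed
  then have "\<lfloor>log 2 \<sigma>\<rfloor> < \<lceil>log 2 \<sigma>\<rceil>"
    by (metis ceiling_correct floor_correct le_less_trans less_le linorder_not_less of_int_less_iff
        le_of_int_ceiling of_int_floor_le)
  with nonneg floor_mono[OF le] show ?thesis by (auto simp: eq)
qed

section \<open>Intersection graphs of disks\<close>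

lemma disks_meet_iff:
  assumes "d i > 0" "d j > 0"
  shows "disk v d i \<inter> disk v d j \<noteq> {} \<longleftrightarrow> dist (v i) (v j) \<le> (d i + d j) / 2"
proof
  assume "disk v d i \<inter> disk v d j \<noteq> {}"
  then obtain x where "dist (v i) x \<le> d i / 2" "dist (v j) x \<le> d j / 2"
    by (auto simp: disk_def)
  then show "dist (v i) (v j) \<le> (d i + d j) / 2"
    using dist_triangle2[of "v i" "v j" x] by (simp add: add_divide_distrib)
next
  assume le: "dist (v i) (v j) \<le> (d i + d j) / 2"
  \<comment> \<open>The common point \<open>x\<close> divides the segment between the centers in the
    ratio of the two radii.\<close>
  define s where "s = d i / (d i + d j)"
  define x where "x = v i + s *\<^sub>R (v j - v i)"
  have s: "s \<ge> 0" "1 - s \<ge> 0" "s * ((d i + d j) / 2) = d i / 2"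
    "(1 - s) * ((d i + d j) / 2) = d j / 2"
    using assms by (auto simp: s_def field_simps)
  have "v j - x = (1 - s) *\<^sub>R (v j - v i)" by (simp add: x_def algebra_simps)
  then have "dist (v j) x = (1 - s) * dist (v i) (v j)"
    using s by (simp add: dist_norm norm_minus_commute)
  moreover have "dist (v i) x = s * dist (v i) (v j)"
    using s by (simp add: dist_norm x_def norm_minus_commute)
  ultimately have "dist (v i) x \<le> d i / 2" "dist (v j) x \<le> d j / 2"
    using mult_left_mono[OF le s(1)] mult_left_mono[OF le s(2)] s(3,4) by auto
  then show "disk v d i \<inter> disk v d j \<noteq> {}" by (auto simp: disk_def)
qed

lemma clique_card_le:
  assumes "finite V" "K \<subseteq> V" "clique K E"
  shows "card K \<le> clique_number V E"
  unfolding clique_number_def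
proof (rule Max_ge)
  show "finite {card K | K. K \<subseteq> V \<and> clique K E}"
    using assms(1) by (auto intro: finite_subset[of _ "card ` Pow V"])
qed (use assms in auto)

lemma dist_scaled:
  fixes p q :: "'a :: real_normed_vector"
  assumes "a > 0"
  shows "dist (p /\<^sub>R a) (q /\<^sub>R a) = dist p q / a"
  using assms
  by (simp add: dist_norm scaleR_diff_right[symmetric] divide_inverse mult.commute)

text \<open>The history of each vertex considered is an initial part of the one set
  \<open>insert i (earlier \<sigma> d i)\<close>, so all counters can be evaluated inside this
  set.\<close>

lemma earlier_in_branch:
  assumes "u \<in> insert i (earlier \<sigma> d i)"
  shows "branch \<sigma> d u = branch \<sigma> d i"
    "earlier \<sigma> d u = {u' \<in> insert i (earlier \<sigma> d i). u' < u}"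
  using assms by (auto simp: earlier_def)

theorem mainTheorem12:
  fixes \<sigma> :: real and b k n :: nat
    and \<phi> :: "nat \<Rightarrow> real ^ 2 \<Rightarrow> nat"
    and L :: "nat \<Rightarrow> (real ^ 2) set set"
    and \<eta> :: "(real ^ 2) set \<Rightarrow> nat"
    and v :: "nat \<Rightarrow> real ^ 2" and d :: "nat \<Rightarrow> real"
  assumes "\<sigma> > 1"
    and "solid_fold_coloring b k \<phi> L"
    and "shading b L \<eta>"
    and "\<And>i. i \<in> {1..n} \<Longrightarrow> d i \<in> {1..\<sigma>}"
  defines "c \<equiv> branch_fold_color b k \<phi> L \<eta> \<sigma> v d"
    and "\<omega> \<equiv> clique_number {1..n} (disk_edges n v d)"
    and "\<gamma> \<equiv> max_subtiles b L"
  shows "proper_coloring {1..n} (disk_edges n v d) c \<and>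
    int (card (fst ` c ` {1..n})) \<le> \<lceil>log 2 \<sigma>\<rceil> \<and>
    (\<forall>i\<in>{1..n}. int (snd (c i)) \<le>
       int k * \<lfloor>(real \<omega> + (real b - 1) * real \<gamma> / 2) / real b\<rfloor>)"
proof -
  note solid = assms(2) and sh = assms(3)
  note part = solid_partition[OF solid]
  define a where "a i = (2::real) powi branch \<sigma> d i" for i
  \<comment> \<open>\<open>w i u\<close> is the position of \<open>u\<close> after undoing the
    scaling of the branch of \<open>i\<close>; it depends on \<open>i\<close> only through that
    branch.\<close>
  define w where "w i u = v u /\<^sub>R a i" for i u
  define l where "l = bfc_layer b L \<eta> \<sigma> v d"
  define t where "t = bfc_rank b L \<eta> \<sigma> v d"
  have a: "a i > 0" for i by (simp add: a_def)
  then have a0: "a i \<noteq> 0" for i by (simp add: less_imp_neq[symmetric])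
  have b: "b > 0" using shading_pos[OF sh] .
  have d: "d i > 0" "a i \<le> d i" "d i \<le> 2 * a i" if "i \<in> {1..n}" for i
    using assms(4)[OF that] branch_bounds[of d i \<sigma>] by (auto simp: a_def)
  have l_eq: "l u = 1 + (\<eta> (subtile_of b L (w u u)) - 1 +
      card {u' \<in> earlier \<sigma> d u. w u u' \<in> subtile_of b L (w u u)}) mod b" for u
    unfolding l_def bfc_layer_def Let_def a_def[symmetric] w_def
      mem_scaled_subtile_of_iff[OF part a0] scale_shading_subtile_of[OF part a0] by simp
  have l: "l i \<in> {1..b}" for i
    using b mod_less_divisor[of b] by (auto simp: l_eq Suc_le_eq)
  have t_eq: "t i = card {u \<in> earlier \<sigma> d i. w i u \<in> tile_of L (l i) (w i i) \<and> l u = l i}" for i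
    unfolding t_def bfc_rank_def Let_def a_def[symmetric] l_def[symmetric] w_def
      mem_scaled_tile_of_iff[where L = L, OF bspec[OF part l] a0] by simp
  have c_eq: "c i = (branch \<sigma> d i, \<phi> (l i) (w i i) + k * t i)" for i
    by (simp add: c_def branch_fold_color_def scale_coloring_def a_def w_def l_def t_def)
  have \<phi>: "\<phi> (l i) p \<in> {1..k}" for i p
    using solid l unfolding solid_fold_coloring_def fold_coloring_def by blast
  have fin: "finite (earlier \<sigma> d i)" for i by (simp add: earlier_def)

  \<comment> \<open>Properness of the coloring\<close>
  have "c i \<noteq> c j" if ij: "i \<in> {1..n}" "j \<in> {1..n}" "i < j"
    and meet: "disk v d i \<inter> disk v d j \<noteq> {}" for i j
  proof
    assume "c i = c j"
    then have br: "branch \<sigma> d i = branch \<sigma> d j"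
      and eq: "\<phi> (l i) (w i i) + k * t i = \<phi> (l j) (w j j) + k * t j" by (auto simp: c_eq)
    from br have aij: "a i = a j" and wij: "w i = w j" by (auto simp: a_def w_def)
    \<comment> \<open>Colors of \<phi> lie in \<open>{1..k}\<close>; lowered by 1 they become
      remainders modulo \<open>k\<close>, so division by \<open>k\<close> recovers the
      ranks.\<close>
    have "(\<phi> (l i) (w i i) - 1) + k * t i = (\<phi> (l j) (w j j) - 1) + k * t j"
      using eq \<phi>[of i "w i i"] \<phi>[of j "w j j"] by auto
    moreover have "\<phi> (l i) (w i i) - 1 < k" "\<phi> (l j) (w j j) - 1 < k"
      using \<phi>[of i "w i i"] \<phi>[of j "w j j"] by auto
    ultimately have t: "t i = t j"
      by (metis add.right_neutral add_cancel_right_right div_less div_mult_self2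
          le_zero_eq not_less_zero add.left_neutral)
    with eq have col: "\<phi> (l i) (w i i) = \<phi> (l j) (w j j)" by simp
    \<comment> \<open>Both diameters are at most \<open>2 * a j\<close>, hence so is their mean,
      which is the sum of the radii.\<close>
    have "dist (v i) (v j) \<le> 2 * a j"
      using meet disks_meet_iff[of d i j v] d[OF ij(1)] d[OF ij(2)] aij by auto
    then have "dist (w i i) (w j j) \<le> 2"
      using a[of j] by (simp add: w_def aij dist_scaled divide_le_eq)
    then have tile: "l i = l j" "tile_of L (l i) (w i i) = tile_of L (l j) (w j j)"
      by (rule solid_close_tile[OF solid l l col])+
    \<comment> \<open>The rank of \<open>j\<close> counts everything that the rank of
      \<open>i\<close> counts, and in addition \<open>i\<close> itself.\<close>
    have "{u \<in> earlier \<sigma> d i. w i u \<in> tile_of L (l i) (w i i) \<and> l u = l i} \<subset>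
        {u \<in> earlier \<sigma> d j. w j u \<in> tile_of L (l j) (w j j) \<and> l u = l j}"
    proof (rule psubsetI)
      show "{u \<in> earlier \<sigma> d i. w i u \<in> tile_of L (l i) (w i i) \<and> l u = l i} \<subseteq>
        {u \<in> earlier \<sigma> d j. w j u \<in> tile_of L (l j) (w j j) \<and> l u = l j}"
        using ij br tile wij by (auto simp: earlier_def)
      have "i \<in> {u \<in> earlier \<sigma> d j. w j u \<in> tile_of L (l j) (w j j) \<and> l u = l j}"
        using ij br tile wij tile_of_mem(2)[where L = L, OF bspec[OF part l[of i]], of "w i i"]
        by (auto simp: earlier_def)
      moreover have "i \<notin> earlier \<sigma> d i" by (simp add: earlier_def)
      ultimately show "{u \<in> earlier \<sigma> d i. w i u \<in> tile_of L (l i) (w i i) \<and> l u = l i} \<noteq>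
        {u \<in> earlier \<sigma> d j. w j u \<in> tile_of L (l j) (w j j) \<and> l u = l j}" by blast
    qed
    then have "t i < t j"
      unfolding t_eq using fin by (intro psubset_card_mono) auto
    with t show False by simp
  qed
  then have ne: "c i \<noteq> c j" if "i \<in> {1..n}" "j \<in> {1..n}" "i \<noteq> j"
    "disk v d i \<inter> disk v d j \<noteq> {}" for i j
    using that by (metis Int_commute linorder_neqE_nat)
  have proper: "proper_coloring {1..n} (disk_edges n v d) c"
    unfolding proper_coloring_def disk_edges_def
    using ne by (auto simp: doubleton_eq_iff)

  \<comment> \<open>Number of branches\<close>
  have "fst ` c ` {1..n} \<subseteq> {0..<\<lceil>log 2 \<sigma>\<rceil>}"
    using branch_range[where d = d, OF assms(1) assms(4)] by (auto simp: c_eq)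
  then have "card (fst ` c ` {1..n}) \<le> card {0..<\<lceil>log 2 \<sigma>\<rceil>}"
    by (rule card_mono[rotated]) simp
  moreover have "\<lceil>log 2 \<sigma>\<rceil> \<ge> 0" 
    using ceiling_mono[of 0 "log 2 \<sigma>"] assms(1) by simp
  ultimately have branches: "int (card (fst ` c ` {1..n})) \<le> \<lceil>log 2 \<sigma>\<rceil>"
    unfolding card_atLeastLessThan_int by linarith

  \<comment> \<open>Size of the second coordinate\<close>
  have "int (snd (c i)) \<le> int k * \<lfloor>(real \<omega> + (real b - 1) * real \<gamma> / 2) / real b\<rfloor>"
    if i: "i \<in> {1..n}" for i
  proof -
    \<comment> \<open>Including \<open>i\<close> itself makes the number of vertices of its layer in
      its tile equal to its rank plus one, and puts \<open>i\<close> into the clique.\<close>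
    define A where "A = insert i (earlier \<sigma> d i)"
    define T where "T = tile_of L (l i) (w i i)"
    have T: "T \<in> L (l i)" "w i i \<in> T"
      unfolding T_def by (rule tile_of_mem[where L = L, OF bspec[OF part l[of i]]])+
    have finA: "finite A" using fin by (simp add: A_def)
    have An: "A \<subseteq> {1..n}" using i by (auto simp: A_def earlier_def)
    have inA: "a u = a i" "w u = w i" "earlier \<sigma> d u = {u' \<in> A. u' < u}" if "u \<in> A" for u
      using earlier_in_branch(1)[OF that[unfolded A_def]]
        earlier_in_branch(2)[OF that[unfolded A_def], folded A_def]
      by (simp_all add: a_def fun_eq_iff w_def)
    have layA: "l u = 1 + (\<eta> (subtile_of b L (w i u)) - 1 +
        card {u' \<in> A. u' < u \<and> w i u' \<in> subtile_of b L (w i u)}) mod b" if "u \<in> A" for u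
      using l_eq[of u] inA[OF that] by simp
    have "{u \<in> A. w i u \<in> T \<and> l u = l i} =
        insert i {u \<in> earlier \<sigma> d i. w i u \<in> T \<and> l u = l i}"
      using T by (auto simp: A_def)
    then have rank: "card {u \<in> A. w i u \<in> T \<and> l u = l i} = Suc (t i)"
      unfolding t_eq T_def[symmetric] using fin by (simp add: earlier_def)
    \<comment> \<open>Two centers in one scaled tile are less than \<open>a i\<close> apart, while
      all diameters in the branch are at least \<open>a i\<close>; hence the distance is at most the
      sum of the radii.\<close>
    have "clique {u \<in> A. w i u \<in> T} (disk_edges n v d)"
      unfolding clique_def
    proof (intro ballI impI)
      fix x y assume x: "x \<in> {u \<in> A. w i u \<in> T}" and y: "y \<in> {u \<in> A. w i u \<in> T}" and "x \<noteq> y"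
      have "dist (w i x) (w i y) < 1"
        using x y by (intro solid_tile_dist[OF solid l T(1)]) auto
      then have "dist (v x) (v y) \<le> a i"
        using a[of i] by (simp add: w_def dist_scaled divide_less_eq)
      moreover have "x \<in> {1..n}" "y \<in> {1..n}" using x y An by auto
      moreover have "a i \<le> d x" "a i \<le> d y"
        using x y d(2) \<open>x \<in> {1..n}\<close> \<open>y \<in> {1..n}\<close> inA(1) by fastforce+
      ultimately have "disk v d x \<inter> disk v d y \<noteq> {}"
        using disks_meet_iff[of d x y v] d(1) by auto
      with \<open>x \<in> {1..n}\<close> \<open>y \<in> {1..n}\<close> \<open>x \<noteq> y\<close> show "{x, y} \<in> disk_edges n v d"
        unfolding disk_edges_def by blast
    qed
    then have \<omega>: "card {u \<in> A. w i u \<in> T} \<le> \<omega>"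
      unfolding \<omega>_def using An by (intro clique_card_le) auto
    have \<gamma>: "card (subtiles_in b L T) \<le> \<gamma>"
      unfolding \<gamma>_def by (rule card_subtiles_in_le_max[OF solid l T(1)])
    have "2 * int b * int (Suc (t i)) \<le>
        2 * int (card {u \<in> A. w i u \<in> T}) + (int b - 1) * int (card (subtiles_in b L T))"
      using card_layer_in_tile_le[where w = "w i" and lay = l, OF solid sh l T(1) finA layA] rank
      by simp
    also have "\<dots> \<le> 2 * int \<omega> + (int b - 1) * int \<gamma>"
      using \<omega> \<gamma> b by (intro add_mono mult_left_mono) auto
    finally have "2 * int b * int (Suc (t i)) \<le> 2 * int \<omega> + (int b - 1) * int \<gamma>" .
    then have "real_of_int (2 * int b * int (Suc (t i))) \<le>
        real_of_int (2 * int \<omega> + (int b - 1) * int \<gamma>)"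
      by (simp only: of_int_le_iff)
    then have "real (Suc (t i)) \<le> (real \<omega> + (real b - 1) * real \<gamma> / 2) / real b"
      using b by (simp add: field_simps)
    then have floor: "int (Suc (t i)) \<le> \<lfloor>(real \<omega> + (real b - 1) * real \<gamma> / 2) / real b\<rfloor>"
      by (simp add: le_floor_iff)
    \<comment> \<open>The color of \<phi> is at most \<open>k\<close>, which accounts for one more
      multiple of \<open>k\<close> beyond the rank.\<close>
    have "snd (c i) \<le> k * Suc (t i)" using \<phi>[of i "w i i"] by (simp add: c_eq)
    then have "int (snd (c i)) \<le> int k * int (Suc (t i))"
      by (metis of_nat_le_iff of_nat_mult)
    also have "\<dots> \<le> int k * \<lfloor>(real \<omega> + (real b - 1) * real \<gamma> / 2) / real b\<rfloor>"
      using floor by (intro mult_left_mono) auto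
    finally show ?thesis .
  qed
  with proper branches show ?thesis by blast
qed

end
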